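(* The matrix $$A=\begin{pmatrix}1&2&0\\0&1&2\\-7&0&29\end{pmatrix}$$ is not of Frobenius type.
   Context: $M(3,\mathbb{Z})$ denotes the set of $3\times 3$ matrices with integer entries whose characteristic polynomial is irreducible over $\mathbb{Q}$. For integers $a_1,a_2,a_3$, the Frobenius matrix is $$M_{a_1,a_2,a_3}=\begin{pmatrix} 0 & 1 & 0 \\ 0 & 0 & 1 \\ a_3 & a_2 & a_1 \end{pmatrix}.$$ A matrix $A\in M(3,\mathbb{Z})$ is said to be of Frobenius type if there exist integers $a_1,a_2,a_3$ and a matrix $X\in SL(3,\mathbb{Z})$ such that $XAX^{-1}$ commutes with $M_{a_1,a_2,a_3}$. *)

theory Defs
  imports "Jordan_Normal_Form.Char_Poly"
begin

text \<open>The ambient set in which the notion of Frobenius type is defined.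
  Irreducibility is over the rationals, so the integer characteristic polynomial is
  mapped to \<^typ>\<open>rat poly\<close> first.\<close>

definition M3Z :: "int mat set" where
  "M3Z = {A \<in> carrier_mat 3 3. irreducible (map_poly rat_of_int (char_poly A))}"

definition SL3Z :: "int mat set" where
  "SL3Z = {X \<in> carrier_mat 3 3. det X = 1}"

definition frobenius_mat :: "int \<Rightarrow> int \<Rightarrow> int \<Rightarrow> int mat" where
  "frobenius_mat a1 a2 a3 = mat_of_rows_list 3
     [[0, 1, 0],
      [0, 0, 1],
      [a3, a2, a1]]"

text \<open>\<open>Y\<close> is the (unique) two-sided inverse of \<open>X\<close>; there is no total inverse operation
  on integer matrices.\<close>

definition frobenius_type :: "int mat \<Rightarrow> bool" where
  "frobenius_type A \<longleftrightarrow> A \<in> M3Z \<and>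
     (\<exists>a1 a2 a3. \<exists>X \<in> SL3Z. \<exists>Y \<in> carrier_mat 3 3.
        inverts_mat X Y \<and> inverts_mat Y X \<and>
        (X * A * Y) * frobenius_mat a1 a2 a3 = frobenius_mat a1 a2 a3 * (X * A * Y))"

end

(* Put B = A - I. The integer matrices in the centralizer of A are the p + q B + s C with C = B^2/2
   and p, q, s integers. If N is such a matrix, then for every integer row vector u the determinant with
   rows u, u N, u N^2 equals the index form I(q,s) times det (u, u B, u C). Modulo 7 the index form
   is 2 q^3, which is never 1 or -1 because the cubes modulo 7 are 0, 1, -1. If A were of Frobenius
   type, some conjugate N of a Frobenius matrix by an element of SL(3,Z) would commute with A,
   and the first row of the conjugating matrix would be a u with determinant 1, making I(q,s) a unit. *)

theory Submission
  imports Defs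
begin

lemma less_3_cases: "i < (3::nat) \<longleftrightarrow> i = 0 \<or> i = 1 \<or> i = 2"
  by auto

lemma mat_of_rows_list_3:
  "mat_of_rows_list 3 [r0, r1, r2] = mat 3 3 (\<lambda>(i, j). [r0, r1, r2] ! i ! j)"
  by (simp add: mat_of_rows_list_def numeral_3_eq_3)

lemma mult_mat_3:
  assumes "P \<in> carrier_mat 3 3" "Q \<in> carrier_mat 3 3" "i < 3" "j < 3"
  shows "(P * Q) $$ (i, j) = P $$ (i, 0) * Q $$ (0, j) + P $$ (i, 1) * Q $$ (1, j) + P $$ (i, 2) * Q $$ (2, j)"
  using assms by (simp add: scalar_prod_def eval_nat_numeral add.assoc)

lemma mat_of_rows_list_3_carrier: "mat_of_rows_list 3 [r0, r1, r2] \<in> carrier_mat 3 3"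
  by (simp add: mat_of_rows_list_3)

lemma det_mat_3:
  fixes P :: "'a :: comm_ring_1 mat"
  assumes P: "P \<in> carrier_mat 3 3"
  shows "det P =
    P $$ (0,0) * (P $$ (1,1) * P $$ (2,2) - P $$ (1,2) * P $$ (2,1))
  - P $$ (0,1) * (P $$ (1,0) * P $$ (2,2) - P $$ (1,2) * P $$ (2,0))
  + P $$ (0,2) * (P $$ (1,0) * P $$ (2,1) - P $$ (1,1) * P $$ (2,0))"
proof -
  have det2: "det Q = Q $$ (0,0) * Q $$ (1,1) - Q $$ (0,1) * Q $$ (1,0)"
    if Q: "Q \<in> carrier_mat 2 2" for Q :: "'a mat"
    using Q by (subst laplace_expansion_row[OF Q, of 0])
      (auto simp: cofactor_def det_single mat_delete_def lessThan_Suc eval_nat_numeral)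
  show ?thesis
    using P by (subst laplace_expansion_row[OF P, of 0])
      (auto simp: cofactor_def det2 mat_delete_def lessThan_Suc eval_nat_numeral algebra_simps)
qed

text \<open>The factor degrees add up to 3, so unless one factor is constant one of them is linear,
  and a linear factor over a field has a root.\<close>

lemma irreducible_cubic_if_no_root:
  fixes p :: "'a :: field poly"
  assumes deg: "degree p = 3" and no_root: "\<And>x. poly p x \<noteq> 0"
  shows "irreducible p"
proof (rule irreducibleI)
  show "p \<noteq> 0" using deg by auto
  show "\<not> p dvd 1" using deg by (auto simp: is_unit_iff_degree[OF \<open>p \<noteq> 0\<close>])
next
  fix a b assume p: "p = a * b"
  with deg have nz: "a \<noteq> 0" "b \<noteq> 0" by auto
  have deg_ab: "degree a + degree b = 3"
    using deg p degree_mult_eq[OF nz] by simp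
  have not_1: "degree f \<noteq> 1" if "f dvd p" for f
  proof
    assume "degree f = 1"
    then obtain c d where f: "f = [:c, d:]" and "d \<noteq> 0" by (rule degree1_coeffs)
    then have "poly f (- c / d) = 0" by simp
    with that no_root[of "- c / d"] show False by (auto elim!: dvdE)
  qed
  from not_1[of a] not_1[of b] p have "degree a \<noteq> 1" "degree b \<noteq> 1" by auto
  with deg_ab have "degree a = 0 \<or> degree b = 0" by linarith
  then show "a dvd 1 \<or> b dvd 1" using nz by (auto simp: is_unit_iff_degree)
qed

text \<open>Rational root test: in lowest terms, a root a / b of this monic cubic must have b = 1,
  and then a divides the constant term. The values at 1 and -1 are 28 and -92.\<close>

lemma no_rational_root:
  fixes x :: rat
  shows "x ^ 3 - 31 * x ^ 2 + 59 * x - 1 \<noteq> 0"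
proof
  assume root: "x ^ 3 - 31 * x ^ 2 + 59 * x - 1 = 0"
  obtain a b where ab: "quotient_of x = (a, b)" by fastforce
  then have cop: "coprime a b" and b: "b > 0" and x: "x = of_int a / of_int b"
    by (auto intro: quotient_of_coprime quotient_of_denom_pos quotient_of_div)
  \<comment> \<open>Multiplying by b^3 clears the denominators and gives a homogeneous cubic in a
    and b.\<close>
  have "rat_of_int (a ^ 3 - 31 * a ^ 2 * b + 59 * a * b ^ 2 - b ^ 3)
      = of_int b ^ 3 * (x ^ 3 - 31 * x ^ 2 + 59 * x - 1)"
    using b by (simp add: x field_simps power2_eq_square power3_eq_cube)
  then have eq: "a ^ 3 - 31 * a ^ 2 * b + 59 * a * b ^ 2 - b ^ 3 = 0"
    unfolding root by (simp only: mult_zero_right of_int_eq_0_iff)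
  have "a ^ 3 = b * (31 * a ^ 2 - 59 * a * b + b ^ 2)"
    using eq by (simp add: algebra_simps power2_eq_square power3_eq_cube)
  then have "b dvd a ^ 3" by simp
  moreover have "coprime b (a ^ 3)" using cop by (simp add: coprime_commute)
  ultimately have "b = 1"
    using b by (metis coprime_common_divisor dvd_refl zdvd1_eq abs_of_pos)
  with eq have "a * (a ^ 2 - 31 * a + 59) = 1"
    by (simp add: algebra_simps power2_eq_square power3_eq_cube)
  then have "a = 1 \<or> a = -1" using zmult_eq_1_iff by blast
  with \<open>b = 1\<close> eq show False by auto
qed

lemma cube_mod_7: "(q::int) ^ 3 mod 7 \<in> {0, 1, 6}"
proof -
  have "q mod 7 \<in> {0..<7}" by simp
  also have "{0..<7::int} = {0, 1, 2, 3, 4, 5, 6}" by auto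
  finally have "(q mod 7) ^ 3 mod 7 \<in> {0, 1, 6}" by auto
  then show ?thesis by (simp add: power_mod)
qed

lemma index_form_not_unit:
  fixes q s :: int
  shows "\<not> 2 * q ^ 3 + 56 * q ^ 2 * s + 392 * q * s ^ 2 + 7 * s ^ 3 dvd 1"
proof
  define e where "e = 2 * q ^ 3 + 56 * q ^ 2 * s + 392 * q * s ^ 2 + 7 * s ^ 3"
  assume "2 * q ^ 3 + 56 * q ^ 2 * s + 392 * q * s ^ 2 + 7 * s ^ 3 dvd 1"
  then have "e = 1 \<or> e = -1" by (auto simp: e_def abs_if split: if_splits)
  \<comment> \<open>Since 56 and 392 are multiples of 7, only 2 q^3 survives modulo 7, with residues
    0, 2, 5. In this grouping the contradiction is linear in q^3 and the bracket.\<close>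
  moreover have "e = 2 * q ^ 3 + 7 * (8 * q ^ 2 * s + 56 * q * s ^ 2 + s ^ 3)"
    by (simp add: e_def)
  moreover have "q ^ 3 mod 7 = 0 \<or> q ^ 3 mod 7 = 1 \<or> q ^ 3 mod 7 = 6"
    using cube_mod_7[of q] by simp
  ultimately show False by presburger
qed

abbreviation paper_mat :: "int mat" where
  "paper_mat \<equiv> mat_of_rows_list 3 [[1, 2, 0], [0, 1, 2], [-7, 0, 29]]"

lemma paper_mat_carrier: "paper_mat \<in> carrier_mat 3 3"
  by (rule mat_of_rows_list_3_carrier)

lemma frobenius_mat_carrier: "frobenius_mat a1 a2 a3 \<in> carrier_mat 3 3"
  unfolding frobenius_mat_def by (rule mat_of_rows_list_3_carrier)

lemma char_poly_paper_mat: "char_poly paper_mat = [:-1, 59, -31, 1:]"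
proof -
  have "char_poly_matrix paper_mat \<in> carrier_mat 3 3"
    using paper_mat_carrier by simp
  from det_mat_3[OF this] show ?thesis
    by (simp add: char_poly_def char_poly_matrix_def mat_of_rows_list_def)
qed

lemma paper_mat_in_M3Z: "paper_mat \<in> M3Z"
proof -
  have "irreducible [:-1, 59, -31, 1::rat:]"
    using no_rational_root
    by (intro irreducible_cubic_if_no_root) (simp_all add: algebra_simps power2_eq_square power3_eq_cube)
  then show ?thesis
    using paper_mat_carrier by (simp add: M3Z_def char_poly_paper_mat map_poly_pCons)
qed

lemma centralizer_paper_mat:
  assumes N: "N \<in> carrier_mat 3 3" and comm: "paper_mat * N = N * paper_mat"
  obtains p q s where "N = mat_of_rows_list 3
    [[p, 2 * q, 2 * s],
     [-7 * s, p, 2 * q + 28 * s],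
     [-7 * q - 98 * s, -7 * s, p + 28 * q + 392 * s]]"
proof -
  have eq: "paper_mat $$ (i, 0) * N $$ (0, j) + paper_mat $$ (i, 1) * N $$ (1, j) + paper_mat $$ (i, 2) * N $$ (2, j)
      = N $$ (i, 0) * paper_mat $$ (0, j) + N $$ (i, 1) * paper_mat $$ (1, j) + N $$ (i, 2) * paper_mat $$ (2, j)"
    if "i < 3" "j < 3" for i j
    using mult_mat_3[OF paper_mat_carrier N that] mult_mat_3[OF N paper_mat_carrier that] comm by argo
  have lin:
    "2 * N $$ (1, 0) = - 7 * N $$ (0, 2)"
    "N $$ (1, 1) = N $$ (0, 0)"
    "N $$ (1, 2) = N $$ (0, 1) + 14 * N $$ (0, 2)"
    "2 * N $$ (2, 0) = - 7 * N $$ (1, 2)"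
    "N $$ (2, 1) = N $$ (1, 0)"
    "N $$ (2, 2) = N $$ (1, 1) + 14 * N $$ (1, 2)"
    using eq[of 0 0] eq[of 0 1] eq[of 0 2] eq[of 1 0] eq[of 1 1] eq[of 1 2]
    by (simp_all add: mat_of_rows_list_3)
  \<comment> \<open>As 7 is odd, the equations with a coefficient 2 on the left force these entries
    to be even. This integrality makes q and s integers.\<close>
  have "even (N $$ (0, 2))" "even (N $$ (1, 2))"
    using lin(1,4) by presburger+
  with lin(3) have "even (N $$ (0, 1))" by presburger
  with \<open>even (N $$ (0, 2))\<close> obtain q s where qs: "N $$ (0, 1) = 2 * q" "N $$ (0, 2) = 2 * s"
    by (auto elim!: evenE)
  show thesis
    by (rule that[of "N $$ (0, 0)" q s], rule eq_matI)
      (use N lin qs in \<open>auto simp: mat_of_rows_list_3 less_3_cases\<close>)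
qed

text \<open>The first two rows of a Frobenius matrix shift coordinates, so the rows of X are u, u N,
  u N^2 with u its first row. The cubic form is the determinant of the coordinates of I, N, N^2 in
  the basis I, B, C, where B = A - I and C = B^2/2. It does not involve p, because adding p I to N
  only causes row operations.\<close>

lemma det_cyclic_row:
  fixes p q s :: int
  assumes X: "X \<in> carrier_mat 3 3"
    and N: "N = mat_of_rows_list 3
      [[p, 2 * q, 2 * s],
       [-7 * s, p, 2 * q + 28 * s],
       [-7 * q - 98 * s, -7 * s, p + 28 * q + 392 * s]]"
    and XN: "X * N = frobenius_mat a1 a2 a3 * X"
  shows "2 * q ^ 3 + 56 * q ^ 2 * s + 392 * q * s ^ 2 + 7 * s ^ 3 dvd det X"
proof -
  have N_carrier: "N \<in> carrier_mat 3 3" unfolding N by (rule mat_of_rows_list_3_carrier)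
  let ?M = "frobenius_mat a1 a2 a3"
  have eq: "X $$ (i, 0) * N $$ (0, j) + X $$ (i, 1) * N $$ (1, j) + X $$ (i, 2) * N $$ (2, j)
      = ?M $$ (i, 0) * X $$ (0, j) + ?M $$ (i, 1) * X $$ (1, j) + ?M $$ (i, 2) * X $$ (2, j)"
    if "i < 3" "j < 3" for i j
    using mult_mat_3[OF X N_carrier that] mult_mat_3[OF frobenius_mat_carrier[of a1 a2 a3] X that] XN by argo
  define a b c where "a = X $$ (0, 0)" and "b = X $$ (0, 1)" and "c = X $$ (0, 2)"
  note abc = a_def[symmetric] b_def[symmetric] c_def[symmetric]
  \<comment> \<open>Row 0 of \<open>X * N = M * X\<close> gives this row as u N; row 1 of the same
    identity then yields the last row as (u N) N.\<close>
  have row1: "X $$ (1, 0) = a * p - 7 * b * s + c * (- 7 * q - 98 * s)"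
    "X $$ (1, 1) = 2 * a * q + b * p - 7 * c * s"
    "X $$ (1, 2) = 2 * a * s + b * (2 * q + 28 * s) + c * (p + 28 * q + 392 * s)"
    using eq[of 0 0] eq[of 0 1] eq[of 0 2]
    by (simp_all add: N frobenius_mat_def mat_of_rows_list_3 abc[simplified])
  define d e f where "d = X $$ (1, 0)" and "e = X $$ (1, 1)" and "f = X $$ (1, 2)"
  note def = d_def[symmetric] e_def[symmetric] f_def[symmetric]
  have row2: "X $$ (2, 0) = d * p - 7 * e * s + f * (- 7 * q - 98 * s)"
    "X $$ (2, 1) = 2 * d * q + e * p - 7 * f * s"
    "X $$ (2, 2) = 2 * d * s + e * (2 * q + 28 * s) + f * (p + 28 * q + 392 * s)"
    using eq[of 1 0] eq[of 1 1] eq[of 1 2]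
    by (simp_all add: N frobenius_mat_def mat_of_rows_list_3 def[simplified])
  \<comment> \<open>The second factor is the determinant with rows u, u B, u C for u = (a, b, c).\<close>
  have "det X = (2 * q ^ 3 + 56 * q ^ 2 * s + 392 * q * s ^ 2 + 7 * s ^ 3)
    * (a * (2 * a * (2 * a + 28 * b + 392 * c) - (2 * b + 28 * c) * (- 7 * c))
     - b * (- 7 * c * (2 * a + 28 * b + 392 * c) - (2 * b + 28 * c) * (- 7 * b - 98 * c))
     + c * (- 7 * c * (- 7 * c) - 2 * a * (- 7 * b - 98 * c)))"
    unfolding det_mat_3[OF X] row2 unfolding d_def e_def f_def row1 abc
    by (simp add: algebra_simps power2_eq_square power3_eq_cube)
  then show ?thesis by simp
qed

lemma paper_mat_not_frobenius_type: "\<not> frobenius_type paper_mat"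
proof
  assume "frobenius_type paper_mat"
  then obtain a1 a2 a3 X Y where X: "X \<in> carrier_mat 3 3" and det: "det X = 1"
    and Y: "Y \<in> carrier_mat 3 3" and XY: "X * Y = 1\<^sub>m 3" and YX: "Y * X = 1\<^sub>m 3"
    and comm: "(X * paper_mat * Y) * frobenius_mat a1 a2 a3 = frobenius_mat a1 a2 a3 * (X * paper_mat * Y)"
    by (auto simp: frobenius_type_def SL3Z_def inverts_mat_def)
  define M where "M = frobenius_mat a1 a2 a3"
  define A where "A = paper_mat"
  have M: "M \<in> carrier_mat 3 3" unfolding M_def by (rule frobenius_mat_carrier)
  have A: "A \<in> carrier_mat 3 3" unfolding A_def by (rule paper_mat_carrier)
  \<comment> \<open>Conjugating the Frobenius matrix back by X turns commutation with
    \<open>X * A * Y\<close> into commutation with A itself.\<close>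
  define N where "N = Y * M * X"
  have N: "N \<in> carrier_mat 3 3" using X Y M by (simp add: N_def)
  note assoc = assoc_mult_mat[where ?n\<^sub>1 = 3 and ?n\<^sub>2 = 3 and ?n\<^sub>3 = 3 and ?n\<^sub>4 = 3]
  have cancel: "Y * (X * Q) = Q" "X * (Y * Q) = Q" if "Q \<in> carrier_mat 3 3" for Q
    using that X Y by (simp_all add: XY YX flip: assoc)
  have XN: "X * N = M * X"
    using X Y M by (simp add: N_def assoc cancel)
  \<comment> \<open>Here \<open>Y * X\<close> cancels to the identity in front of A, and so does the
    \<open>Y * X\<close> behind it on the way to \<open>N * A\<close>.\<close>
  have "A * N = Y * ((X * A * Y) * M) * X"
    using X Y M A by (simp add: N_def assoc cancel)
  also have "\<dots> = Y * (M * (X * A * Y)) * X"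
    using comm by (simp only: M_def A_def)
  also have "\<dots> = N * A"
    using X Y M A by (simp add: N_def assoc YX)
  finally have "A * N = N * A" .
  with N obtain p q s where "N = mat_of_rows_list 3
    [[p, 2 * q, 2 * s],
     [-7 * s, p, 2 * q + 28 * s],
     [-7 * q - 98 * s, -7 * s, p + 28 * q + 392 * s]]"
    unfolding A_def by (rule centralizer_paper_mat)
  from det_cyclic_row[OF X this XN[unfolded M_def]] index_form_not_unit[of q s] det
  show False by simp
qed

theorem mainTheorem6:
  fixes A :: "int mat"
  assumes "A = mat_of_rows_list 3
     [[1, 2, 0],
      [0, 1, 2],
      [-7, 0, 29]]"
  shows "A \<in> M3Z \<and> \<not> frobenius_type A"
  using paper_mat_in_M3Z paper_mat_not_frobenius_type assms by simp

end
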